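(* Let $d\ge 2$ and let $F_1,\dots,F_d$ be distribution functions that are symmetric with zero means. Let $U\sim U[0,1]$, and let $G_i$ denote the distribution function of $|X_i|$ when $X_i\sim F_i$. There exists a random vector $(X_1,\dots,X_d)$ with $X_i\sim F_i$ for all $i$ such that $|X_1|,\dots,|X_d|$ are comonotonic and $\prod_{i=1}^d X_i\ge 0$ a.s. Hence $$M=\mathbb{E}\left(\prod_{i=1}^d G_i^{-1}(U)\right),$$ and $M$ is attained by this vector. Furthermore, such a vector is given by $X_i=F_i^{-1}(U_i)$, $i=1,\dots,d$, where the $U_i$ are as follows. If $d$ is odd, $$\begin{aligned}U_1&=U_2=\cdots=U_{d-2}=U,\\ U_{d-1}&=IJU+I(1-J)(1-U)+(1-I)JU+(1-I)(1-J)(1-U),\\ U_d&=IJU+I(1-J)(1-U)+(1-I)J(1-U)+(1-I)(1-J)U,\end{aligned}$$ where $I=\mathbf{1}_{U>1/2}$, $J=\mathbf{1}_{V>1/2}$, and $V\sim U[0,1]$ is independent of $U$. If $d$ is even, $U_1=U_2=\cdots=U_d=U$.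
   Context: All random variables $X_i\sim F_i$ are square integrable. $X\sim F$ means that $X$ has distribution function $F$, and $F^{-1}$ is the (generalized, left-continuous) inverse, i.e. the quantile function, of $F$. A distribution function with zero mean is symmetric if $X\sim F$ implies $-X\sim F$. Define $M=\sup \mathbb{E}(X_1X_2\cdots X_d)$, where the supremum is over all random vectors $(X_1,\dots,X_d)$ with $X_i\sim F_i$ for all $i$ and arbitrary dependence, for which the expectation is well defined (in $[-\infty,\infty]$). A vector with $X_i\sim F_i$ for all $i$ attains $M$ if $\mathbb{E}(X_1\cdots X_d)=M$. Random variables $Y_1,\dots,Y_d$ are comonotonic if $(Y_1,\dots,Y_d)$ has the same law as $(H_1^{-1}(W),\dots,H_d^{-1}(W))$, where $Y_i\sim H_i$ and $W\sim U[0,1]$. *)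

theory Defs
  imports "HOL-Probability.Probability"
begin

definition distribution_function :: "(real \<Rightarrow> real) \<Rightarrow> bool" where
  "distribution_function F \<longleftrightarrow>
     mono F \<and> (\<forall>a. continuous (at_right a) F) \<and>
     (F \<longlongrightarrow> 0) at_bot \<and> (F \<longlongrightarrow> 1) at_top"

definition has_df :: "'a measure \<Rightarrow> ('a \<Rightarrow> real) \<Rightarrow> (real \<Rightarrow> real) \<Rightarrow> bool" where
  "has_df P X F \<longleftrightarrow> X \<in> borel_measurable P \<and> cdf (distr P borel X) = F"

text \<open>For a distribution function \<open>F\<close>, \<open>interval_measure F\<close> is the law of every random
  variable with distribution function \<open>F\<close>; the next four notions depend only on this law.\<close>

definition square_integrable_df :: "(real \<Rightarrow> real) \<Rightarrow> bool" where
  "square_integrable_df F \<longleftrightarrow> integrable (interval_measure F) (\<lambda>x. x\<^sup>2)"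

definition mean_df :: "(real \<Rightarrow> real) \<Rightarrow> real" where
  "mean_df F = (LINT x|interval_measure F. x)"

definition symmetric_df :: "(real \<Rightarrow> real) \<Rightarrow> bool" where
  "symmetric_df F \<longleftrightarrow> has_df (interval_measure F) (\<lambda>x. - x) F"

definition abs_df :: "(real \<Rightarrow> real) \<Rightarrow> real \<Rightarrow> real" where
  "abs_df F = cdf (distr (interval_measure F) borel (\<lambda>x. \<bar>x\<bar>))"

text \<open>This is the left-continuous inverse for \<open>0 < u < 1\<close>. For other \<open>u\<close> the set can be empty
  or unbounded below and the value is an unspecified real; a uniform variable takes such values
  with probability zero.\<close>

definition quantile :: "(real \<Rightarrow> real) \<Rightarrow> real \<Rightarrow> real" where
  "quantile F u = Inf {x. u \<le> F x}"

definition uniform01 :: "'a measure \<Rightarrow> ('a \<Rightarrow> real) \<Rightarrow> bool" where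
  "uniform01 P U \<longleftrightarrow> U \<in> borel_measurable P \<and> distr P borel U = uniform_measure lborel {0..1}"

text \<open>\<open>has_expectation P Y e\<close>: the expectation of \<open>Y\<close> is well defined in the extended reals (the
  positive or the negative part has finite expectation) and equals \<open>e\<close>.\<close>

definition has_expectation :: "'a measure \<Rightarrow> ('a \<Rightarrow> real) \<Rightarrow> ereal \<Rightarrow> bool" where
  "has_expectation P Y e \<longleftrightarrow> Y \<in> borel_measurable P \<and>
     ((\<integral>\<^sup>+ \<omega>. ennreal (Y \<omega>) \<partial>P) < \<infinity> \<or> (\<integral>\<^sup>+ \<omega>. ennreal (- Y \<omega>) \<partial>P) < \<infinity>) \<and>
     e = enn2ereal (\<integral>\<^sup>+ \<omega>. ennreal (Y \<omega>) \<partial>P) - enn2ereal (\<integral>\<^sup>+ \<omega>. ennreal (- Y \<omega>) \<partial>P)"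

definition vector_with_dfs ::
  "'a measure \<Rightarrow> nat \<Rightarrow> (nat \<Rightarrow> real \<Rightarrow> real) \<Rightarrow> (nat \<Rightarrow> 'a \<Rightarrow> real) \<Rightarrow> bool" where
  "vector_with_dfs P d F X \<longleftrightarrow> prob_space P \<and> (\<forall>i\<in>{1..d}. has_df P (X i) (F i))"

text \<open>The sample spaces range over all probability spaces with points in \<open>nat \<Rightarrow> real\<close>. This loses
  nothing: every law on \<open>\<real>\<^sup>d\<close> is that of the coordinate process on such a space (see
  \<open>expectation_le_max_product\<close> below).\<close>

definition max_product :: "nat \<Rightarrow> (nat \<Rightarrow> real \<Rightarrow> real) \<Rightarrow> ereal" where
  "max_product d F = Sup {e. \<exists>(P :: (nat \<Rightarrow> real) measure) X.
     vector_with_dfs P d F X \<and> has_expectation P (\<lambda>\<omega>. \<Prod>i\<in>{1..d}. X i \<omega>) e}"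

definition attains_max_product ::
  "'a measure \<Rightarrow> nat \<Rightarrow> (nat \<Rightarrow> real \<Rightarrow> real) \<Rightarrow> (nat \<Rightarrow> 'a \<Rightarrow> real) \<Rightarrow> bool" where
  "attains_max_product P d F X \<longleftrightarrow> vector_with_dfs P d F X \<and>
     has_expectation P (\<lambda>\<omega>. \<Prod>i\<in>{1..d}. X i \<omega>) (max_product d F)"

definition comonotonic :: "'a measure \<Rightarrow> nat \<Rightarrow> (nat \<Rightarrow> 'a \<Rightarrow> real) \<Rightarrow> bool" where
  "comonotonic P d Y \<longleftrightarrow> (\<forall>i\<in>{1..d}. Y i \<in> borel_measurable P) \<and>
     distr P (PiM {1..d} (\<lambda>_. borel)) (\<lambda>\<omega>. \<lambda>i\<in>{1..d}. Y i \<omega>) =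
     distr (uniform_measure lborel {0..1}) (PiM {1..d} (\<lambda>_. borel))
       (\<lambda>w. \<lambda>i\<in>{1..d}. quantile (cdf (distr P borel (Y i))) w)"

definition odd_coupling :: "nat \<Rightarrow> real \<Rightarrow> real \<Rightarrow> nat \<Rightarrow> real" where
  "odd_coupling d u v i =
    (let I = of_bool (u > 1/2); J = of_bool (v > 1/2) in
     if i = d - 1 then
       I * J * u + I * (1 - J) * (1 - u) + (1 - I) * J * u + (1 - I) * (1 - J) * (1 - u)
     else if i = d then
       I * J * u + I * (1 - J) * (1 - u) + (1 - I) * J * (1 - u) + (1 - I) * (1 - J) * u
     else u)"

lemma expectation_le_max_product:
  fixes P :: "'a measure"
  assumes X: "vector_with_dfs P d F X"
    and e: "has_expectation P (\<lambda>\<omega>. \<Prod>i\<in>{1..d}. X i \<omega>) e"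
  shows "e \<le> max_product d F"
proof -
  let ?N = "PiM {1..d} (\<lambda>_. borel :: real measure)"
  define T where "T = (\<lambda>\<omega>. \<lambda>i\<in>{1..d}. X i \<omega>)"
  define Q where "Q = distr P ?N T"
  define C :: "nat \<Rightarrow> (nat \<Rightarrow> real) \<Rightarrow> real" where "C = (\<lambda>i x. x i)"
  have Xm: "X i \<in> borel_measurable P" if "i \<in> {1..d}" for i
    using X that by (auto simp: vector_with_dfs_def has_df_def)
  have Tm: "T \<in> measurable P ?N"
    unfolding T_def by (rule measurable_restrict) (use Xm in auto)
  have Cm: "C i \<in> borel_measurable ?N" if "i \<in> {1..d}" for i
    unfolding C_def using that by (rule measurable_component_singleton)
  have CT: "C i (T \<omega>) = X i \<omega>" if "i \<in> {1..d}" for i \<omega>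
    using that by (simp add: C_def T_def)
  have "distr Q borel (C i) = distr P borel (X i)" if "i \<in> {1..d}" for i
    unfolding Q_def using that
    by (subst distr_distr[OF Cm[OF that] Tm]) (auto simp: comp_def CT)
  moreover have "prob_space Q"
    unfolding Q_def using X Tm by (intro prob_space.prob_space_distr) (auto simp: vector_with_dfs_def)
  moreover have "sets Q = sets ?N" by (simp add: Q_def)
  ultimately have 1: "vector_with_dfs Q d F C"
    using X Cm by (auto simp: vector_with_dfs_def has_df_def cong: measurable_cong_sets)
  have pm: "(\<lambda>x. \<Prod>i\<in>{1..d}. C i x) \<in> borel_measurable ?N"
    using Cm by (intro borel_measurable_prod) auto
  have prod: "(\<Prod>i\<in>{1..d}. C i (T \<omega>)) = (\<Prod>i\<in>{1..d}. X i \<omega>)" for \<omega>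
    by (intro prod.cong) (auto simp: CT)
  have "(\<integral>\<^sup>+ x. ennreal (\<Prod>i\<in>{1..d}. C i x) \<partial>Q) = (\<integral>\<^sup>+ \<omega>. ennreal (\<Prod>i\<in>{1..d}. X i \<omega>) \<partial>P)"
    unfolding Q_def prod[symmetric]
    by (rule nn_integral_distr[OF Tm]) (simp add: measurable_compose[OF pm measurable_ennreal] del: One_nat_def)
  moreover have "(\<integral>\<^sup>+ x. ennreal (- (\<Prod>i\<in>{1..d}. C i x)) \<partial>Q) = (\<integral>\<^sup>+ \<omega>. ennreal (- (\<Prod>i\<in>{1..d}. X i \<omega>)) \<partial>P)"
    unfolding Q_def prod[symmetric]
    by (rule nn_integral_distr[OF Tm])
       (simp add: measurable_compose[OF borel_measurable_uminus[OF pm] measurable_ennreal] del: One_nat_def)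
  moreover have "(\<lambda>x. \<Prod>i\<in>{1..d}. C i x) \<in> borel_measurable Q"
    using pm by (simp add: Q_def)
  ultimately have 2: "has_expectation Q (\<lambda>x. \<Prod>i\<in>{1..d}. C i x) e"
    using e unfolding has_expectation_def by metis
  show ?thesis
    unfolding max_product_def using 1 2 by (intro Sup_upper) blast
qed

end

theory Submission
  imports Defs
begin

text \<open>The upper bound is a rearrangement inequality for \<open>\<bar>X\<^sub>1\<bar>, \<dots>, \<bar>X\<^sub>d\<bar>\<close>. Strengthen it to
  \<open>E(1\<^sub>A Y\<^sub>1 \<dots> Y\<^sub>n) \<le> \<integral> G\<^sub>1\<inverse>(u) \<dots> G\<^sub>n\<inverse>(u) du\<close> over \<open>1 - P(A) < u < 1\<close>, for every event \<open>A\<close>; induction on \<open>n\<close>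
  then works by the layer-cake formula for \<open>Y\<^sub>n\<close>, because the factor \<open>1\<close> on \<open>{Y\<^sub>n > t}\<close> is absorbed
  into \<open>A\<close>, and \<open>P(A \<inter> {Y\<^sub>n > t}) \<le> min (P(A)) (1 - G\<^sub>n(t))\<close>.

  For attainment, symmetry gives \<open>\<bar>F\<inverse>(u)\<bar> = G\<inverse>(\<bar>2u - 1\<bar>)\<close> outside a countable set, and \<open>F\<inverse>(u)\<close> has
  the sign of \<open>u - 1/2\<close>. Hence if all \<open>U\<^sub>i\<close> are uniform with values in \<open>{U, 1 - U}\<close> and the product of
  the \<open>U\<^sub>i - 1/2\<close> is nonnegative, then \<open>\<bar>X\<^sub>i\<bar> = G\<^sub>i\<inverse>(\<bar>2U - 1\<bar>)\<close> for all \<open>i\<close> and the product of the \<open>X\<^sub>i\<close>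
  is nonnegative.\<close>

section \<open>The uniform law on the unit interval\<close>

abbreviation unif01 :: "real measure" where
  "unif01 \<equiv> uniform_measure lborel {0..1}"

lemma prob_space_unif01: "prob_space unif01"
  by (rule prob_space_uniform_measure) auto

lemma real_distribution_unif01: "real_distribution unif01"
  using prob_space_unif01 by (simp add: real_distribution_def real_distribution_axioms_def)

lemma AE_unif01_I:
  assumes "AE u in lborel. 0 < u \<longrightarrow> u < 1 \<longrightarrow> Q u"
  shows "AE u in unif01. Q u"
proof (rule AE_uniform_measureI)
  show "AE u in lborel. u \<in> {0..1} \<longrightarrow> Q u"
    using assms AE_lborel_singleton[of 0] AE_lborel_singleton[of 1]
    by eventually_elim auto
qed simp

text \<open>The endpoints are null. Passing to the open interval matters because
  \<open>quantile\<close> is controlled only at levels strictly between 0 and 1.\<close>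

lemma nn_integral_unif01:
  assumes [measurable]: "f \<in> borel_measurable borel"
  shows "(\<integral>\<^sup>+u. f u \<partial>unif01) = (\<integral>\<^sup>+u. f u * indicator {0<..<1} u \<partial>lborel)"
proof -
  have "(\<integral>\<^sup>+u. f u \<partial>unif01) = (\<integral>\<^sup>+u. f u * indicator {0..1} u \<partial>lborel)"
    by (subst nn_integral_uniform_measure) (auto simp: divide_ennreal_def)
  also have "\<dots> = (\<integral>\<^sup>+u. f u * indicator {0<..<1} u \<partial>lborel)"
  proof (rule nn_integral_cong_AE)
    show "AE u in lborel. f u * indicator {0..1} u = f u * indicator {0<..<1} u"
      using AE_lborel_singleton[of 0] AE_lborel_singleton[of 1]
      by eventually_elim (auto split: split_indicator)
  qed
  finally show ?thesis .
qed

lemma measure_unif01_atMost: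
  assumes "0 \<le> t" "t \<le> 1"
  shows "measure unif01 {..t} = t"
proof -
  have "{0..1} \<inter> {..t} = {0..t}" using assms by auto
  then show ?thesis using assms by (subst measure_uniform_measure) auto
qed

text \<open>For \<open>t\<close> in the unit interval the sublevel set is an interval of length
  \<open>t\<close> centred at 1/2. This makes \<open>\<bar>2 * U - 1\<bar>\<close> the uniform
  variable that drives all absolute values.\<close>

lemma distr_unif01_abs: "distr unif01 borel (\<lambda>u. \<bar>2 * u - 1\<bar>) = unif01"
proof (rule cdf_unique[OF _ real_distribution_unif01])
  interpret U: prob_space unif01 by (rule prob_space_unif01)
  show "real_distribution (distr unif01 borel (\<lambda>u. \<bar>2 * u - 1\<bar>))" by simp
  show "cdf (distr unif01 borel (\<lambda>u. \<bar>2 * u - 1\<bar>)) = cdf unif01"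
  proof
    fix t :: real
    have 1: "cdf (distr unif01 borel (\<lambda>u. \<bar>2 * u - 1\<bar>)) t = measure lborel ({0..1} \<inter> {u. \<bar>2 * u - 1\<bar> \<le> t})"
      by (subst cdf_def, subst measure_distr, simp, simp, subst measure_uniform_measure)
         (auto simp: vimage_def)
    have 2: "cdf unif01 t = measure lborel ({0..1} \<inter> {..t})"
      by (subst cdf_def, subst measure_uniform_measure) auto
    consider "t < 0" | "0 \<le> t" "t \<le> 1" | "1 < t" by linarith
    then show "cdf (distr unif01 borel (\<lambda>u. \<bar>2 * u - 1\<bar>)) t = cdf unif01 t"
    proof cases
      case 1
      then have "{0..1} \<inter> {u. \<bar>2 * u - 1\<bar> \<le> t} = {}" "{0..1} \<inter> {..t} = {}" by auto
      then show ?thesis using \<open>cdf (distr _ _ _) t = _\<close> 2 by metis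
    next
      case 2
      then have "{0..1} \<inter> {u. \<bar>2 * u - 1\<bar> \<le> t} = {(1 - t) / 2..(1 + t) / 2}" "{0..1} \<inter> {..t} = {0..t}"
        by (auto simp: abs_le_iff)
      then show ?thesis using \<open>cdf (distr _ _ _) t = _\<close> \<open>cdf unif01 t = _\<close> 2
        by (simp add: field_simps)
    next
      case 3
      then have "{0..1} \<inter> {u. \<bar>2 * u - 1\<bar> \<le> t} = {0..1}" "{0..1} \<inter> {..t} = {0..1}" by auto
      then show ?thesis using \<open>cdf (distr _ _ _) t = _\<close> 2 by metis
    qed
  qed
qed

lemma distr_unif01_reflect: "distr unif01 borel (\<lambda>u. 1 - u) = unif01"
proof (rule cdf_unique[OF _ real_distribution_unif01])
  interpret U: prob_space unif01 by (rule prob_space_unif01)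
  show "real_distribution (distr unif01 borel (\<lambda>u. 1 - u))" by simp
  show "cdf (distr unif01 borel (\<lambda>u. 1 - u)) = cdf unif01"
  proof
    fix t :: real
    have 1: "cdf (distr unif01 borel (\<lambda>u. 1 - u)) t = measure lborel ({0..1} \<inter> {u. 1 - u \<le> t})"
      by (subst cdf_def, subst measure_distr, simp, simp, subst measure_uniform_measure)
         (auto simp: vimage_def)
    have 2: "cdf unif01 t = measure lborel ({0..1} \<inter> {..t})"
      by (subst cdf_def, subst measure_uniform_measure) auto
    have 3: "{0..1} \<inter> {u. 1 - u \<le> t} = {max 0 (1 - t)..1}" "{0..1} \<inter> {..t} = {0..min 1 t}"
      by auto
    show "cdf (distr unif01 borel (\<lambda>u. 1 - u)) t = cdf unif01 t"
      unfolding 1 2 3 by (simp add: measure_def max_def min_def emeasure_lborel_Icc_eq)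
  qed
qed

section \<open>Distribution functions and their quantiles\<close>

lemma distribution_function_cdf:
  assumes "real_distribution M"
  shows "distribution_function (cdf M)"
proof -
  interpret real_distribution M by fact
  show ?thesis
    unfolding distribution_function_def
    by (auto intro: monoI cdf_nondecreasing cdf_is_right_cont cdf_lim_at_bot cdf_lim_at_top_prob)
qed

context
  fixes F :: "real \<Rightarrow> real"
  assumes F: "distribution_function F"
begin

lemma real_distribution_df: "real_distribution (interval_measure F)"
  using F unfolding distribution_function_def
  by (intro real_distribution_interval_measure) (auto simp: mono_def)

lemma cdf_df: "cdf (interval_measure F) = F"
  using F unfolding distribution_function_def
  by (intro cdf_interval_measure) (auto simp: mono_def)

lemma df_range: "0 \<le> F x" "F x \<le> 1"
proof -
  interpret real_distribution "interval_measure F" by (rule real_distribution_df)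
  show "0 \<le> F x" "F x \<le> 1"
    using cdf_nonneg[of x] cdf_bounded_prob[of x] by (simp_all add: cdf_df)
qed

lemma right_continuous_mono_df: "right_continuous_mono F 0 1"
  using F unfolding distribution_function_def by unfold_locales auto

text \<open>The Galois connection between \<open>F\<close> and its left-continuous inverse, through
  which later arguments trade levels of \<open>quantile F\<close> for values of
  \<open>F\<close>.\<close>

lemma quantile_le_iff:
  assumes "0 < u" "u < 1"
  shows "quantile F u \<le> x \<longleftrightarrow> u \<le> F x"
  using right_continuous_mono.pseudoinverse[OF right_continuous_mono_df assms, of x] by (simp add: quantile_def)

text \<open>Monotone on the open unit interval, hence measurable there. Since \<open>F\<close> takes
  values between 0 and 1, the set under \<open>Inf\<close> is the whole line for every
  \<open>u \<le> 0\<close> and empty for every \<open>u > 1\<close>, so the unspecified values are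
  constant on each side.\<close>

lemma measurable_quantile: "quantile F \<in> borel_measurable borel"
proof -
  have m: "quantile F \<in> borel_measurable (restrict_space borel {0<..<1})"
    using right_continuous_mono.mono_I[OF right_continuous_mono_df] unfolding quantile_def
    by (intro borel_measurable_mono_on_fnc) auto
  have *: "(\<lambda>u. if u \<in> {0<..<1} then quantile F u else
      if u \<le> 0 then quantile F 0 else if u = 1 then quantile F 1 else quantile F 2) \<in> borel_measurable borel"
    using m by (subst measurable_If_restrict_space_iff) (auto simp: greaterThanLessThan_def greaterThan_def lessThan_def Collect_conj_eq intro: measurable_restrict_space1)
  have "quantile F u = (if u \<in> {0<..<1} then quantile F u else
      if u \<le> 0 then quantile F 0 else if u = 1 then quantile F 1 else quantile F 2)" for u
  proof -
    have 0: "{x. u \<le> F x} = {x. 0 \<le> F x}" if "u \<le> 0"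
    proof -
      have "u \<le> F x" "0 \<le> F x" for x using that df_range(1)[of x] by linarith+
      then show ?thesis by simp
    qed
    have 1: "{x. u \<le> F x} = {x. 2 \<le> F x}" if "1 < u"
    proof -
      have "\<not> u \<le> F x" "\<not> 2 \<le> F x" for x using that df_range(2)[of x] by linarith+
      then show ?thesis by simp
    qed
    consider "u \<in> {0<..<1}" | "u \<le> 0" | "u = 1" | "1 < u" by fastforce
    then show ?thesis
    proof cases
      case 2
      then show ?thesis using arg_cong[OF 0, of Inf] by (simp add: quantile_def)
    next
      case 4
      then show ?thesis using arg_cong[OF 1, of Inf] by (simp add: quantile_def)
    qed simp_all
  qed
  then have "quantile F = (\<lambda>u. if u \<in> {0<..<1} then quantile F u else
      if u \<le> 0 then quantile F 0 else if u = 1 then quantile F 1 else quantile F 2)" (is "_ = ?g") by blast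
  then show ?thesis using * arg_cong[of "quantile F" ?g "\<lambda>f. f \<in> borel_measurable borel"] by blast
qed

lemma distr_quantile: "distr unif01 borel (quantile F) = interval_measure F"
proof (rule cdf_unique[OF _ real_distribution_df])
  interpret U: prob_space unif01 by (rule prob_space_unif01)
  note [measurable] = measurable_quantile
  show "real_distribution (distr unif01 borel (quantile F))" by simp
  show "cdf (distr unif01 borel (quantile F)) = cdf (interval_measure F)"
  proof
    fix x
    have "cdf (distr unif01 borel (quantile F)) x = measure unif01 {u. quantile F u \<le> x}"
      by (simp add: cdf_def measure_distr vimage_def)
    also have "\<dots> = measure unif01 {..F x}"
      \<comment> \<open>The two sets agree inside the open unit interval, hence up to a null
        set.\<close>
      by (intro U.finite_measure_eq_AE AE_unif01_I AE_I2) (auto simp: quantile_le_iff)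
    also have "\<dots> = F x" by (intro measure_unif01_atMost df_range)
    finally show "cdf (distr unif01 borel (quantile F)) x = cdf (interval_measure F) x"
      by (simp add: cdf_df)
  qed
qed

end

lemma has_df_iff_distr:
  assumes "distribution_function F" "prob_space P"
  shows "has_df P X F \<longleftrightarrow> X \<in> borel_measurable P \<and> distr P borel X = interval_measure F"
proof
  assume "has_df P X F"
  then have X: "X \<in> borel_measurable P" "cdf (distr P borel X) = F" by (auto simp: has_df_def)
  then have "cdf (distr P borel X) = cdf (interval_measure F)"
    by (simp add: cdf_df[OF assms(1)])
  with X assms show "X \<in> borel_measurable P \<and> distr P borel X = interval_measure F"
    by (intro conjI cdf_unique prob_space.real_distribution_distr real_distribution_df) auto
next
  assume "X \<in> borel_measurable P \<and> distr P borel X = interval_measure F"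
  then show "has_df P X F" by (simp add: has_df_def cdf_df[OF assms(1)])
qed

section \<open>The rearrangement inequality for products\<close>

lemma ennreal_layer_cake: "(\<integral>\<^sup>+t. (if 0 \<le> t \<and> t < y then 1 else 0) \<partial>lborel) = ennreal y"
proof -
  have "(\<integral>\<^sup>+t. (if 0 \<le> t \<and> t < y then 1 else 0) \<partial>lborel) = (\<integral>\<^sup>+t. indicator {0..<y} t \<partial>lborel)"
    by (intro nn_integral_cong) (auto split: split_indicator)
  also have "\<dots> = ennreal y" by (cases "0 \<le> y") (auto simp: ennreal_neg)
  finally show ?thesis .
qed

lemma nn_integral_prod_indicator_le_quantiles:
  fixes Y :: "'i \<Rightarrow> 'a \<Rightarrow> real"
  assumes P: "prob_space P" and I: "finite I"
    and "\<And>i. i \<in> I \<Longrightarrow> Y i \<in> borel_measurable P" and "A \<in> sets P"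
  shows "(\<integral>\<^sup>+\<omega>. (\<Prod>i\<in>I. ennreal (Y i \<omega>)) * indicator A \<omega> \<partial>P)
    \<le> (\<integral>\<^sup>+u. (\<Prod>i\<in>I. ennreal (quantile (cdf (distr P borel (Y i))) u)) *
          indicator {1 - measure P A<..<1} u \<partial>lborel)"
  using I assms(3-)
proof (induction I arbitrary: A)
  interpret prob_space P by fact
  case empty
  \<comment> \<open>With no factors both sides are the probability of \<open>A\<close>.\<close>
  then show ?case by (simp add: emeasure_eq_measure)
next
  interpret prob_space P by fact
  case (insert j I)
  interpret P1: pair_sigma_finite P "lborel :: real measure" ..
  note [measurable] = insert.prems(2)
  have Ym: "Y i \<in> borel_measurable P" if "i \<in> insert j I" for i
    using insert.prems(1) that by blast
  then have Yj[measurable]: "Y j \<in> borel_measurable P" by blast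
  have df: "distribution_function (cdf (distr P borel (Y i)))" if "i \<in> insert j I" for i
    using Ym[OF that] by (intro distribution_function_cdf) simp
  define G where "G = cdf (distr P borel (Y j))"
  define p where "p \<omega> = (\<Prod>i\<in>I. ennreal (Y i \<omega>))" for \<omega>
  define q where "q u = (\<Prod>i\<in>I. ennreal (quantile (cdf (distr P borel (Y i))) u))" for u
  have pm[measurable]: "p \<in> borel_measurable P"
    unfolding p_def using Ym by (intro borel_measurable_prod_ennreal) auto
  have qm[measurable]: "q \<in> borel_measurable borel"
    unfolding q_def using measurable_quantile[OF df]
    by (intro borel_measurable_prod_ennreal) auto
  have G: "distribution_function G" unfolding G_def by (rule df) simp
  have [measurable]: "quantile G \<in> borel_measurable borel" by (rule measurable_quantile[OF G])
  \<comment> \<open>The inequality at one level \<open>t\<close> of the layer-cake formula for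
    \<open>Y j\<close>; integrating over \<open>t\<close> then restores the factor.\<close>
  have step: "(\<integral>\<^sup>+\<omega>. p \<omega> * indicator A \<omega> * (if 0 \<le> t \<and> t < Y j \<omega> then 1 else 0) \<partial>P)
     \<le> (\<integral>\<^sup>+u. q u * indicator {1 - measure P A<..<1} u * (if 0 \<le> t \<and> t < quantile G u then 1 else 0) \<partial>lborel)"
    for t :: real
  proof (cases "0 \<le> t")
    case True
    define B where "B = {\<omega> \<in> space P. t < Y j \<omega>}"
    have [measurable]: "B \<in> sets P" unfolding B_def by measurable
    have "measure P B = 1 - G t"
    proof -
      have "G t = measure P {\<omega> \<in> space P. \<not> t < Y j \<omega>}"
        unfolding G_def cdf_def
        by (subst measure_distr) (auto intro!: arg_cong[where f="measure P"])
      then show ?thesis unfolding B_def by (subst (asm) prob_neg) auto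
    qed
    then have AB: "measure P (A \<inter> B) \<le> measure P A" "measure P (A \<inter> B) \<le> 1 - G t"
      using finite_measure_mono[of "A \<inter> B" A] finite_measure_mono[of "A \<inter> B" B] by auto
    have "(\<integral>\<^sup>+\<omega>. p \<omega> * indicator A \<omega> * (if 0 \<le> t \<and> t < Y j \<omega> then 1 else 0) \<partial>P)
        = (\<integral>\<^sup>+\<omega>. p \<omega> * indicator (A \<inter> B) \<omega> \<partial>P)"
      using True by (intro nn_integral_cong) (auto simp: B_def split: split_indicator)
    \<comment> \<open>The induction hypothesis is applied to the smaller event
      \<open>A \<inter> B\<close>.\<close>
    also have "\<dots> \<le> (\<integral>\<^sup>+u. q u * indicator {1 - measure P (A \<inter> B)<..<1} u \<partial>lborel)"
      unfolding p_def q_def using Ym by (intro insert.IH) auto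
    also have "\<dots> \<le> (\<integral>\<^sup>+u. q u * indicator {1 - measure P A<..<1} u * (if 0 \<le> t \<and> t < quantile G u then 1 else 0) \<partial>lborel)"
    proof (intro nn_integral_mono)
      fix u :: real
      \<comment> \<open>The two bounds in \<open>AB\<close> give one condition each: the first keeps
        \<open>u\<close> in the interval belonging to \<open>A\<close>, the second gives
        \<open>G t < u\<close>, that is \<open>t < quantile G u\<close>.\<close>
      have "u > 1 - measure P A" "t < quantile G u" if "1 - measure P (A \<inter> B) < u" "u < 1"
      proof -
        show "u > 1 - measure P A" using that AB by linarith
        have "0 < u" using that prob_le_1[of "A \<inter> B"] by linarith
        moreover have "\<not> u \<le> G t" using that AB by linarith
        ultimately show "t < quantile G u" using quantile_le_iff[OF G, of u t] that by auto
      qed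
      then show "q u * indicator {1 - measure P (A \<inter> B)<..<1} u
        \<le> q u * indicator {1 - measure P A<..<1} u * (if 0 \<le> t \<and> t < quantile G u then 1 else 0)"
        using True by (auto split: split_indicator)
    qed
    finally show ?thesis .
  qed auto
  have "(\<integral>\<^sup>+\<omega>. (\<Prod>i\<in>insert j I. ennreal (Y i \<omega>)) * indicator A \<omega> \<partial>P)
      = (\<integral>\<^sup>+\<omega>. p \<omega> * indicator A \<omega> * (\<integral>\<^sup>+t. (if 0 \<le> t \<and> t < Y j \<omega> then 1 else 0) \<partial>lborel) \<partial>P)"
    unfolding ennreal_layer_cake p_def using insert.hyps by (simp add: mult_ac)
  also have "\<dots> = (\<integral>\<^sup>+\<omega>. (\<integral>\<^sup>+t. p \<omega> * indicator A \<omega> * (if 0 \<le> t \<and> t < Y j \<omega> then 1 else 0) \<partial>lborel) \<partial>P)"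
    by (intro nn_integral_cong nn_integral_cmult[symmetric]) measurable
  \<comment> \<open>Tonelli puts the level \<open>t\<close> outside so that \<open>step\<close>
    applies; the same exchange later turns the indicators back into
    \<open>quantile G\<close>.\<close>
  also have "\<dots> = (\<integral>\<^sup>+t. (\<integral>\<^sup>+\<omega>. p \<omega> * indicator A \<omega> * (if 0 \<le> t \<and> t < Y j \<omega> then 1 else 0) \<partial>P) \<partial>lborel)"
    by (intro P1.Fubini'[symmetric]) measurable
  also have "\<dots> \<le> (\<integral>\<^sup>+t. (\<integral>\<^sup>+u. q u * indicator {1 - measure P A<..<1} u *
      (if 0 \<le> t \<and> t < quantile G u then 1 else 0) \<partial>lborel) \<partial>lborel)"
    by (intro nn_integral_mono step)
  also have "\<dots> = (\<integral>\<^sup>+u. (\<integral>\<^sup>+t. q u * indicator {1 - measure P A<..<1} u *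
      (if 0 \<le> t \<and> t < quantile G u then 1 else 0) \<partial>lborel) \<partial>lborel)"
    by (intro lborel_pair.Fubini') measurable
  also have "\<dots> = (\<integral>\<^sup>+u. q u * indicator {1 - measure P A<..<1} u *
      (\<integral>\<^sup>+t. (if 0 \<le> t \<and> t < quantile G u then 1 else 0) \<partial>lborel) \<partial>lborel)"
    by (intro nn_integral_cong nn_integral_cmult) measurable
  also have "\<dots> = (\<integral>\<^sup>+u. (\<Prod>i\<in>insert j I. ennreal (quantile (cdf (distr P borel (Y i))) u)) *
          indicator {1 - measure P A<..<1} u \<partial>lborel)"
    unfolding ennreal_layer_cake q_def G_def using insert.hyps by (simp add: mult_ac)
  finally show ?case .
qed

text \<open>The case where the event is the whole space, so that the interval of levels is the open
  unit interval.\<close>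

lemma nn_integral_prod_le_quantiles:
  fixes Y :: "'i \<Rightarrow> 'a \<Rightarrow> real"
  assumes P: "prob_space P" and I: "finite I"
    and Y: "\<And>i. i \<in> I \<Longrightarrow> Y i \<in> borel_measurable P"
  shows "(\<integral>\<^sup>+\<omega>. (\<Prod>i\<in>I. ennreal (Y i \<omega>)) \<partial>P)
    \<le> (\<integral>\<^sup>+u. (\<Prod>i\<in>I. ennreal (quantile (cdf (distr P borel (Y i))) u)) \<partial>unif01)"
proof -
  interpret prob_space P by fact
  have df: "distribution_function (cdf (distr P borel (Y i)))" if "i \<in> I" for i
    using Y[OF that] by (intro distribution_function_cdf) simp
  have "(\<integral>\<^sup>+\<omega>. (\<Prod>i\<in>I. ennreal (Y i \<omega>)) \<partial>P)
      = (\<integral>\<^sup>+\<omega>. (\<Prod>i\<in>I. ennreal (Y i \<omega>)) * indicator (space P) \<omega> \<partial>P)"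
    by (intro nn_integral_cong) simp
  also have "\<dots> \<le> (\<integral>\<^sup>+u. (\<Prod>i\<in>I. ennreal (quantile (cdf (distr P borel (Y i))) u)) *
          indicator {1 - measure P (space P)<..<1} u \<partial>lborel)"
    by (intro nn_integral_prod_indicator_le_quantiles assms) auto
  also have "\<dots> = (\<integral>\<^sup>+u. (\<Prod>i\<in>I. ennreal (quantile (cdf (distr P borel (Y i))) u)) \<partial>unif01)"
    using measurable_quantile[OF df]
    by (subst nn_integral_unif01) (auto simp: prob_space intro!: borel_measurable_prod_ennreal)
  finally show ?thesis .
qed

section \<open>Symmetric distribution functions and the law of the absolute value\<close>

context
  fixes F :: "real \<Rightarrow> real"
  assumes F: "distribution_function F" and sym: "symmetric_df F"
begin

lemma measure_atLeast_symmetric: "measure (interval_measure F) {- s..} = F s"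
proof -
  interpret real_distribution "interval_measure F" by (rule real_distribution_df[OF F])
  have "F s = cdf (distr (interval_measure F) borel (\<lambda>x. - x)) s"
    using sym by (simp add: symmetric_df_def has_df_def)
  also have "\<dots> = measure (interval_measure F) {- s..}"
    by (subst cdf_def, subst measure_distr) (auto intro!: arg_cong[where f="measure _"])
  finally show ?thesis by simp
qed

lemma measure_atMost_df: "measure (interval_measure F) {..s} = F s"
  using cdf_df[OF F] by (metis cdf_def)

text \<open>By symmetry the half-lines \<open>{..r}\<close> and \<open>{- s..}\<close> have masses
  \<open>F r\<close> and \<open>F s\<close>, and here they cover the line. In the companion
  \<open>symmetric_df_add_le\<close> they are disjoint. Together these replace the reflection
  formula for \<open>F\<close>, which would involve left limits.\<close>

lemma symmetric_df_add_ge: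
  assumes "0 \<le> r + s" shows "1 \<le> F r + F s"
proof -
  interpret real_distribution "interval_measure F" by (rule real_distribution_df[OF F])
  have "{..r} \<union> {- s..} = UNIV" using assms by auto
  then have "1 = measure (interval_measure F) ({..r} \<union> {- s..})"
    using prob_space by simp
  also have "\<dots> \<le> F r + F s"
    using measure_Un_le[of "{..r}" "interval_measure F" "{- s..}"]
    by (simp add: measure_atLeast_symmetric measure_atMost_df)
  finally show ?thesis .
qed

lemma symmetric_df_add_le:
  assumes "r + s < 0" shows "F r + F s \<le> 1"
proof -
  interpret real_distribution "interval_measure F" by (rule real_distribution_df[OF F])
  have "F r + F s = measure (interval_measure F) ({..r} \<union> {- s..})"
    using assms by (subst finite_measure_Union) (auto simp: measure_atLeast_symmetric measure_atMost_df)
  also have "\<dots> \<le> 1" by simp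
  finally show ?thesis .
qed

text \<open>For \<open>x \<ge> 0\<close> the interval from \<open>- x\<close> to \<open>x\<close> is
  \<open>{..x}\<close> without the complement of \<open>{- x..}\<close>, whose mass is
  \<open>1 - F x\<close> by symmetry.\<close>

lemma abs_df_eq: "abs_df F x = (if x < 0 then 0 else 2 * F x - 1)"
proof -
  interpret real_distribution "interval_measure F" by (rule real_distribution_df[OF F])
  have 1: "abs_df F x = measure (interval_measure F) {y. \<bar>y\<bar> \<le> x}"
    unfolding abs_df_def by (subst cdf_def, subst measure_distr) (auto intro!: arg_cong[where f="measure _"])
  show ?thesis
  proof (cases "x < 0")
    case True
    then have "{y. \<bar>y\<bar> \<le> x} = {}" by auto
    with True 1 show ?thesis by simp
  next
    case False
    have "{y. \<bar>y\<bar> \<le> x} = {..x} - (UNIV - {- x..})" by auto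
    then have "abs_df F x = measure (interval_measure F) ({..x} - (UNIV - {- x..}))"
      using 1 by simp
    also have "\<dots> = measure (interval_measure F) {..x} - measure (interval_measure F) (UNIV - {- x..})"
      using False by (intro finite_measure_Diff) auto
    also have "measure (interval_measure F) (UNIV - {- x..}) = 1 - F x"
      using prob_compl[of "{- x..}"] by (simp add: measure_atLeast_symmetric)
    finally show ?thesis using False by (simp add: measure_atMost_df)
  qed
qed

text \<open>Both infima run over the same set: for negative \<open>x\<close> neither inequality
  holds, because \<open>F x \<le> 1/2 < u\<close>, and for the others \<open>abs_df F x\<close> is
  \<open>2 * F x - 1\<close>.\<close>

lemma quantile_abs_df:
  assumes "1 / 2 < u" shows "quantile (abs_df F) (2 * u - 1) = quantile F u"
proof -
  have "2 * u - 1 \<le> abs_df F x \<longleftrightarrow> u \<le> F x" for x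
    using assms symmetric_df_add_le[of x x] by (auto simp: abs_df_eq)
  then show ?thesis by (simp add: quantile_def)
qed

lemma quantile_nonneg:
  assumes "1 / 2 < u" "u < 1" shows "0 \<le> quantile F u"
proof (rule ccontr)
  assume "\<not> 0 \<le> quantile F u"
  then have "F (quantile F u) \<le> 1 / 2" using symmetric_df_add_le[of "quantile F u" "quantile F u"] by simp
  moreover have "u \<le> F (quantile F u)" using quantile_le_iff[OF F, of u "quantile F u"] assms by simp
  ultimately show False using assms by simp
qed

lemma quantile_nonpos:
  assumes "0 < u" "u \<le> 1 / 2" shows "quantile F u \<le> 0"
  using quantile_le_iff[OF F, of u 0] symmetric_df_add_ge[of 0 0] assms by simp

text \<open>The left- and right-continuous inverses differ at \<open>u\<close> only if \<open>F = u\<close> on a nondegenerate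
  interval, which then contains a rational.\<close>

lemma quantile_reflect:
  assumes u: "0 < u" "u < 1" and rat: "u \<notin> F ` \<rat>"
  shows "quantile F (1 - u) = - quantile F u"
proof (rule antisym; rule ccontr)
  let ?q = "quantile F u" and ?q' = "quantile F (1 - u)"
  have q: "?q \<le> x \<longleftrightarrow> u \<le> F x" and q': "?q' \<le> x \<longleftrightarrow> 1 - u \<le> F x" for x
    using quantile_le_iff[OF F] u by auto
  {
    assume "\<not> ?q' \<le> - ?q"
    \<comment> \<open>\<open>r\<close> and \<open>s\<close> lie strictly below the two quantiles and
      have positive sum, so \<open>F r + F s\<close> is less than \<open>u + (1 - u)\<close>,
      against \<open>symmetric_df_add_ge\<close>.\<close>
    then obtain r where r: "?q > r" "- ?q' < r"
      using dense[of "- ?q'" ?q] by auto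
    then obtain s where s: "s < ?q'" "- r < s"
      using dense[of "- r" ?q'] by auto
    have "F r < u" "F s < 1 - u" using q[of r] q'[of s] r s by auto
    then show False using symmetric_df_add_ge[of r s] s by simp
  next
    assume "\<not> - ?q \<le> ?q'"
    then have "?q < - ?q'" by simp
    then obtain r where r: "r \<in> \<rat>" "?q < r" "r < - ?q'"
      by (metis Rats_dense_in_real)
    have "F r + F ?q' \<le> 1" using r by (intro symmetric_df_add_le) simp
    moreover have "1 - u \<le> F ?q'" "u \<le> F r" using q[of r] q'[of ?q'] r by auto
    ultimately have "u = F r" by simp
    then show False using rat r by blast
  }
qed

lemma quantile_abs_df_abs:
  assumes u: "0 < u" "u < 1" "u \<noteq> 1 / 2" "u \<notin> F ` \<rat>"
  shows "quantile (abs_df F) \<bar>2 * u - 1\<bar> = \<bar>quantile F u\<bar>"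
proof (cases "1 / 2 < u")
  case True
  then show ?thesis using quantile_abs_df[of u] quantile_nonneg[of u] u by simp
next
  case False
  \<comment> \<open>The lower half is moved to the upper half by \<open>quantile_reflect\<close>,
    which only changes the sign of the quantile.\<close>
  then have "\<bar>2 * u - 1\<bar> = 2 * (1 - u) - 1" using u by simp
  then show ?thesis
    using False quantile_abs_df[of "1 - u"] quantile_nonneg[of "1 - u"] quantile_reflect[of u] u by simp
qed

end

section \<open>The upper bound for the expected product\<close>

lemma cdf_abs_eq_abs_df:
  assumes P: "prob_space P" and F: "distribution_function F" and X: "has_df P X F"
  shows "cdf (distr P borel (\<lambda>\<omega>. \<bar>X \<omega>\<bar>)) = abs_df F"
proof -
  have [measurable]: "X \<in> borel_measurable P" and D: "distr P borel X = interval_measure F"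
    using X has_df_iff_distr[OF F P] by auto
  show ?thesis
    unfolding abs_df_def D[symmetric] by (subst distr_distr) (simp_all add: comp_def)
qed

lemma distribution_function_abs_df:
  assumes "distribution_function F"
  shows "distribution_function (abs_df F)"
proof -
  interpret real_distribution "interval_measure F" by (rule real_distribution_df[OF assms])
  show ?thesis unfolding abs_df_def by (intro distribution_function_cdf real_distribution_distr) simp
qed

text \<open>The value that \<open>max_product d F\<close> turns out to have. It is kept in
  \<open>ennreal\<close> because it can be infinite for \<open>d \<ge> 3\<close>, and it has the
  shape of the right-hand side of the rearrangement inequality.\<close>

definition quantile_product :: "nat \<Rightarrow> (nat \<Rightarrow> real \<Rightarrow> real) \<Rightarrow> ennreal" where
  "quantile_product d F = (\<integral>\<^sup>+u. (\<Prod>i\<in>{1..d}. ennreal (quantile (abs_df (F i)) u)) \<partial>unif01)"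

text \<open>Dropping the negative part and passing to absolute values can only increase the
  expectation; then the rearrangement inequality applies to the
  \<open>\<bar>X i\<bar>\<close>.\<close>

lemma expectation_le_quantile_product:
  assumes F: "\<And>i. i \<in> {1..d} \<Longrightarrow> distribution_function (F i)"
    and X: "vector_with_dfs P d F X"
    and e: "has_expectation P (\<lambda>\<omega>. \<Prod>i\<in>{1..d}. X i \<omega>) e"
  shows "e \<le> enn2ereal (quantile_product d F)"
proof -
  have P: "prob_space P" and X: "\<And>i. i \<in> {1..d} \<Longrightarrow> has_df P (X i) (F i)"
    using X by (auto simp: vector_with_dfs_def)
  let ?p = "\<integral>\<^sup>+\<omega>. ennreal (\<Prod>i\<in>{1..d}. X i \<omega>) \<partial>P"
  have "e \<le> enn2ereal ?p"
    using e unfolding has_expectation_def by (simp add: ereal_diff_le_self)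
  also have "?p \<le> (\<integral>\<^sup>+\<omega>. (\<Prod>i\<in>{1..d}. ennreal \<bar>X i \<omega>\<bar>) \<partial>P)"
    by (intro nn_integral_mono) (simp add: prod_ennreal ennreal_leI flip: abs_prod)
  then have "enn2ereal ?p \<le> enn2ereal (\<integral>\<^sup>+\<omega>. (\<Prod>i\<in>{1..d}. ennreal \<bar>X i \<omega>\<bar>) \<partial>P)"
    by (simp add: less_eq_ennreal.rep_eq)
  also have "(\<integral>\<^sup>+\<omega>. (\<Prod>i\<in>{1..d}. ennreal \<bar>X i \<omega>\<bar>) \<partial>P) \<le>
      (\<integral>\<^sup>+u. (\<Prod>i\<in>{1..d}. ennreal (quantile (cdf (distr P borel (\<lambda>\<omega>. \<bar>X i \<omega>\<bar>))) u)) \<partial>unif01)"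
    using X by (intro nn_integral_prod_le_quantiles P borel_measurable_abs) (simp_all add: has_df_def del: One_nat_def)
  also have "\<dots> = quantile_product d F"
    unfolding quantile_product_def
    by (intro nn_integral_cong prod.cong refl) (simp add: cdf_abs_eq_abs_df[OF P F X])
  finally show ?thesis by (simp add: less_eq_ennreal.rep_eq)
qed

section \<open>Vectors that reach the bound\<close>

lemma AE_uniform01:
  assumes "uniform01 P U" "AE u in unif01. Q u"
  shows "AE \<omega> in P. Q (U \<omega>)"
  using assms AE_distrD[of U P borel Q] unfolding uniform01_def by metis

lemma distr_uniform01_compose:
  assumes "uniform01 P U" "f \<in> borel_measurable borel"
  shows "distr P borel (\<lambda>\<omega>. f (U \<omega>)) = distr unif01 borel f"
  using assms distr_distr[of f borel borel U P] unfolding uniform01_def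
  by (simp add: comp_def cong: distr_cong)

lemma uniform01_compose:
  assumes "uniform01 P U" "f \<in> borel_measurable borel" "distr unif01 borel f = unif01"
  shows "uniform01 P (\<lambda>\<omega>. f (U \<omega>))"
  using assms distr_uniform01_compose[OF assms(1,2)] unfolding uniform01_def
  by (simp add: measurable_compose[OF _ assms(2)])

text \<open>The properties claimed in the theorem, with attainment expressed through
  \<open>quantile_product\<close>. They can thus be proved before \<open>max_product\<close> is
  known, and \<open>sign_aligned_vector_iff\<close> translates back afterwards.\<close>

definition sign_aligned_vector ::
  "'a measure \<Rightarrow> nat \<Rightarrow> (nat \<Rightarrow> real \<Rightarrow> real) \<Rightarrow> (nat \<Rightarrow> 'a \<Rightarrow> real) \<Rightarrow> bool" where
  "sign_aligned_vector P d F X \<longleftrightarrow> vector_with_dfs P d F X \<and> comonotonic P d (\<lambda>i \<omega>. \<bar>X i \<omega>\<bar>) \<and>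
     (AE \<omega> in P. 0 \<le> (\<Prod>i\<in>{1..d}. X i \<omega>)) \<and>
     has_expectation P (\<lambda>\<omega>. \<Prod>i\<in>{1..d}. X i \<omega>) (enn2ereal (quantile_product d F))"

lemma sign_aligned_vector_iff:
  assumes "max_product d F = enn2ereal (quantile_product d F)"
  shows "sign_aligned_vector P d F X \<longleftrightarrow> vector_with_dfs P d F X \<and>
     comonotonic P d (\<lambda>i \<omega>. \<bar>X i \<omega>\<bar>) \<and> (AE \<omega> in P. 0 \<le> (\<Prod>i\<in>{1..d}. X i \<omega>)) \<and>
     attains_max_product P d F X"
  unfolding sign_aligned_vector_def attains_max_product_def assms by blast

lemma has_expectation_nonneg:
  assumes [measurable]: "Y \<in> borel_measurable P" and "AE \<omega> in P. 0 \<le> Y \<omega>"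
  shows "has_expectation P Y (enn2ereal (\<integral>\<^sup>+\<omega>. ennreal (Y \<omega>) \<partial>P))"
proof -
  have "(\<integral>\<^sup>+\<omega>. ennreal (- Y \<omega>) \<partial>P) = (\<integral>\<^sup>+\<omega>. 0 \<partial>P)"
    using assms(2) by (intro nn_integral_cong_AE) (auto simp: ennreal_neg)
  then show ?thesis by (simp add: has_expectation_def zero_ennreal.rep_eq)
qed

lemma nn_integral_uniform01:
  assumes "uniform01 P U" "f \<in> borel_measurable borel"
  shows "(\<integral>\<^sup>+\<omega>. f (U \<omega>) \<partial>P) = (\<integral>\<^sup>+u. f u \<partial>unif01)"
  using assms nn_integral_distr[of U P borel f] unfolding uniform01_def by simp

text \<open>Each quotient \<open>x i / w i\<close> is nonnegative, and the product of the
  \<open>x i\<close> is the product of these quotients times that of the \<open>w i\<close>.\<close>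

lemma prod_nonneg_of_aligned_signs:
  fixes x w :: "'i \<Rightarrow> real"
  assumes "\<And>i. i \<in> I \<Longrightarrow> 0 \<le> x i * w i" "\<And>i. i \<in> I \<Longrightarrow> w i \<noteq> 0" "0 \<le> (\<Prod>i\<in>I. w i)"
  shows "0 \<le> (\<Prod>i\<in>I. x i)"
proof -
  have "0 \<le> x i / w i" if "i \<in> I" for i
    using assms(1)[OF that] by (auto simp: zero_le_mult_iff zero_le_divide_iff)
  then have "0 \<le> (\<Prod>i\<in>I. x i / w i) * (\<Prod>i\<in>I. w i)"
    by (intro mult_nonneg_nonneg[OF prod_nonneg assms(3)]) auto
  also have "\<dots> = (\<Prod>i\<in>I. x i)"
    using assms(2) by (simp flip: prod.distrib)
  finally show ?thesis .
qed

context
  fixes d :: nat and F :: "nat \<Rightarrow> real \<Rightarrow> real"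
  assumes F: "\<And>i. i \<in> {1..d} \<Longrightarrow> distribution_function (F i)"
    and sym: "\<And>i. i \<in> {1..d} \<Longrightarrow> symmetric_df (F i)"
begin

lemma measurable_quantile_abs_df:
  "i \<in> {1..d} \<Longrightarrow> quantile (abs_df (F i)) \<in> borel_measurable borel"
  by (intro measurable_quantile distribution_function_abs_df F)

text \<open>The exceptional levels, where \<open>quantile_reflect\<close> may fail, are images of
  the rationals and hence countable.\<close>

lemma AE_unif01_generic:
  "AE u in unif01. 0 < u \<and> u < 1 \<and> u \<noteq> 1 / 2 \<and> (\<forall>i\<in>{1..d}. u \<notin> F i ` \<rat>)"
proof (rule AE_unif01_I)
  have "countable ({1 / 2} \<union> (\<Union>i\<in>{1..d}. F i ` \<rat>))"
    by (intro countable_Un countable_UN countable_image countable_rat) auto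
  then have "AE u in lborel. u \<notin> {1 / 2} \<union> (\<Union>i\<in>{1..d}. F i ` \<rat>)"
    by (intro AE_not_in countable_imp_null_set_lborel)
  then show "AE u in lborel. 0 < u \<longrightarrow> u < 1 \<longrightarrow>
      0 < u \<and> u < 1 \<and> u \<noteq> 1 / 2 \<and> (\<forall>i\<in>{1..d}. u \<notin> F i ` \<rat>)"
    by eventually_elim blast
qed

text \<open>The construction common to both parities of \<open>d\<close>; only the choice of the
  \<open>W i\<close> differs.\<close>

lemma sign_aligned_vector_quantiles:
  assumes P: "prob_space P" and U: "uniform01 P U"
    and W: "\<And>i. i \<in> {1..d} \<Longrightarrow> uniform01 P (W i)"
    and WU: "\<And>i \<omega>. i \<in> {1..d} \<Longrightarrow> W i \<omega> \<in> {U \<omega>, 1 - U \<omega>}"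
    and W_sign: "\<And>\<omega>. 0 \<le> (\<Prod>i\<in>{1..d}. W i \<omega> - 1 / 2)"
  shows "sign_aligned_vector P d F (\<lambda>i \<omega>. quantile (F i) (W i \<omega>))"
proof -
  interpret prob_space P by fact
  define X where "X i \<omega> = quantile (F i) (W i \<omega>)" for i \<omega>
  define G where "G i = quantile (abs_df (F i))" for i
  define R where "R \<omega> = \<bar>2 * U \<omega> - 1\<bar>" for \<omega>
  have Um[measurable]: "U \<in> borel_measurable P" using U by (simp add: uniform01_def)
  have R: "uniform01 P R"
    unfolding R_def by (rule uniform01_compose[OF U]) (auto simp: distr_unif01_abs)
  then have Rm[measurable]: "R \<in> borel_measurable P" by (simp add: uniform01_def)
  have Xm: "X i \<in> borel_measurable P" if "i \<in> {1..d}" for i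
    using measurable_compose[OF _ measurable_quantile[OF F[OF that]], of "W i" P] W[OF that]
    by (simp add: uniform01_def X_def[abs_def])
  have Gm: "G i \<in> borel_measurable borel" if "i \<in> {1..d}" for i
    unfolding G_def by (rule measurable_quantile_abs_df[OF that])
  have df: "has_df P (X i) (F i)" if "i \<in> {1..d}" for i
    using has_df_iff_distr[OF F[OF that] P, of "X i"] Xm[OF that]
      distr_uniform01_compose[OF W[OF that] measurable_quantile[OF F[OF that]]]
      distr_quantile[OF F[OF that]] by (simp add: X_def[abs_def])
  have vec: "vector_with_dfs P d F X" using P df by (simp add: vector_with_dfs_def)
  have gen: "AE \<omega> in P. \<forall>i\<in>{1..d}. 0 < W i \<omega> \<and> W i \<omega> < 1 \<and> W i \<omega> \<noteq> 1 / 2 \<and> W i \<omega> \<notin> F i ` \<rat>"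
  proof (rule AE_finite_allI)
    fix i assume i: "i \<in> {1..d}"
    show "AE \<omega> in P. 0 < W i \<omega> \<and> W i \<omega> < 1 \<and> W i \<omega> \<noteq> 1 / 2 \<and> W i \<omega> \<notin> F i ` \<rat>"
      using AE_uniform01[OF W[OF i] AE_unif01_generic] by eventually_elim (use i in blast)
  qed simp
  then have absX: "AE \<omega> in P. \<forall>i\<in>{1..d}. \<bar>X i \<omega>\<bar> = G i (R \<omega>)"
  proof eventually_elim
    fix \<omega> assume *: "\<forall>i\<in>{1..d}. 0 < W i \<omega> \<and> W i \<omega> < 1 \<and> W i \<omega> \<noteq> 1 / 2 \<and> W i \<omega> \<notin> F i ` \<rat>"
    show "\<forall>i\<in>{1..d}. \<bar>X i \<omega>\<bar> = G i (R \<omega>)"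
    proof
      fix i assume i: "i \<in> {1..d}"
      \<comment> \<open>\<open>U\<close> and \<open>1 - U\<close> are equally far from 1/2, so every
        \<open>W i\<close> yields the same \<open>R\<close>.\<close>
      have "R \<omega> = \<bar>2 * W i \<omega> - 1\<bar>" using WU[OF i, of \<omega>] by (auto simp: R_def)
      then show "\<bar>X i \<omega>\<bar> = G i (R \<omega>)"
        using quantile_abs_df_abs[OF F[OF i] sym[OF i], of "W i \<omega>"] * i by (simp add: G_def X_def)
    qed
  qed
  have nonneg: "AE \<omega> in P. 0 \<le> (\<Prod>i\<in>{1..d}. X i \<omega>)"
    using gen
  proof eventually_elim
    fix \<omega> assume *: "\<forall>i\<in>{1..d}. 0 < W i \<omega> \<and> W i \<omega> < 1 \<and> W i \<omega> \<noteq> 1 / 2 \<and> W i \<omega> \<notin> F i ` \<rat>"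
    show "0 \<le> (\<Prod>i\<in>{1..d}. X i \<omega>)"
    proof (rule prod_nonneg_of_aligned_signs[OF _ _ W_sign])
      fix i assume i: "i \<in> {1..d}"
      show "W i \<omega> - 1 / 2 \<noteq> 0" using * i by auto
      show "0 \<le> X i \<omega> * (W i \<omega> - 1 / 2)"
        using * i quantile_nonneg[OF F[OF i] sym[OF i], of "W i \<omega>"]
          quantile_nonpos[OF F[OF i] sym[OF i], of "W i \<omega>"]
        by (cases "1 / 2 < W i \<omega>") (auto simp: X_def zero_le_mult_iff)
    qed
  qed
  have Xprod: "(\<lambda>\<omega>. \<Prod>i\<in>{1..d}. X i \<omega>) \<in> borel_measurable P"
    using Xm by (intro borel_measurable_prod) auto
  have "(\<integral>\<^sup>+\<omega>. ennreal (\<Prod>i\<in>{1..d}. X i \<omega>) \<partial>P) = (\<integral>\<^sup>+\<omega>. (\<Prod>i\<in>{1..d}. ennreal (G i (R \<omega>))) \<partial>P)"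
  proof (rule nn_integral_cong_AE)
    show "AE \<omega> in P. ennreal (\<Prod>i\<in>{1..d}. X i \<omega>) = (\<Prod>i\<in>{1..d}. ennreal (G i (R \<omega>)))"
      using nonneg absX
    proof eventually_elim
      fix \<omega> assume 1: "0 \<le> (\<Prod>i\<in>{1..d}. X i \<omega>)" and 2: "\<forall>i\<in>{1..d}. \<bar>X i \<omega>\<bar> = G i (R \<omega>)"
      have "(\<Prod>i\<in>{1..d}. ennreal (G i (R \<omega>))) = (\<Prod>i\<in>{1..d}. ennreal \<bar>X i \<omega>\<bar>)"
        using 2 by (intro prod.cong) auto
      also have "\<dots> = ennreal \<bar>\<Prod>i\<in>{1..d}. X i \<omega>\<bar>"
        by (simp add: prod_ennreal abs_prod)
      finally show "ennreal (\<Prod>i\<in>{1..d}. X i \<omega>) = (\<Prod>i\<in>{1..d}. ennreal (G i (R \<omega>)))"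
        using 1 by simp
    qed
  qed
  also have "\<dots> = quantile_product d F"
    unfolding quantile_product_def G_def[symmetric] using Gm
    by (intro nn_integral_uniform01[OF R] borel_measurable_prod_ennreal measurable_compose[OF _ measurable_ennreal]) auto
  finally have "has_expectation P (\<lambda>\<omega>. \<Prod>i\<in>{1..d}. X i \<omega>) (enn2ereal (quantile_product d F))"
    using has_expectation_nonneg[OF Xprod nonneg] by simp
  moreover have "comonotonic P d (\<lambda>i \<omega>. \<bar>X i \<omega>\<bar>)"
  proof -
    let ?N = "PiM {1..d} (\<lambda>_. borel :: real measure)"
    have Gr: "(\<lambda>w. \<lambda>i\<in>{1..d}. G i w) \<in> measurable borel ?N"
      by (rule measurable_restrict) (rule Gm)
    \<comment> \<open>Almost surely the vector of absolute values is a function of the single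
      uniform variable \<open>R\<close>, which is comonotonicity once its law is pushed
      forward.\<close>
    have "distr P ?N (\<lambda>\<omega>. \<lambda>i\<in>{1..d}. \<bar>X i \<omega>\<bar>) = distr P ?N (\<lambda>\<omega>. \<lambda>i\<in>{1..d}. G i (R \<omega>))"
    proof (rule distr_cong_AE)
      show "AE \<omega> in P. (\<lambda>i\<in>{1..d}. \<bar>X i \<omega>\<bar>) = (\<lambda>i\<in>{1..d}. G i (R \<omega>))"
        using absX by eventually_elim (auto intro!: restrict_ext)
      show "(\<lambda>\<omega>. \<lambda>i\<in>{1..d}. \<bar>X i \<omega>\<bar>) \<in> measurable P ?N"
        using Xm by (intro measurable_restrict borel_measurable_abs) auto
      show "(\<lambda>\<omega>. \<lambda>i\<in>{1..d}. G i (R \<omega>)) \<in> measurable P ?N"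
        using measurable_compose[OF Rm Gr] by simp
    qed simp_all
    also have "\<dots> = distr (distr P borel R) ?N (\<lambda>w. \<lambda>i\<in>{1..d}. G i w)"
      by (subst distr_distr[OF Gr Rm]) (simp add: comp_def)
    also have "distr P borel R = unif01" using R by (simp add: uniform01_def)
    also have "distr unif01 ?N (\<lambda>w. \<lambda>i\<in>{1..d}. G i w) =
        distr unif01 ?N (\<lambda>w. \<lambda>i\<in>{1..d}. quantile (cdf (distr P borel (\<lambda>\<omega>. \<bar>X i \<omega>\<bar>))) w)"
      by (intro distr_cong refl restrict_ext) (simp add: G_def cdf_abs_eq_abs_df[OF P F df])
    finally show ?thesis
      unfolding comonotonic_def using Xm borel_measurable_abs by blast
  qed
  ultimately show ?thesis
    using vec nonneg unfolding sign_aligned_vector_def X_def[abs_def] by blast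
qed

lemma has_expectation_quantile_abs_df:
  assumes U: "uniform01 P U"
  shows "has_expectation P (\<lambda>\<omega>. \<Prod>i\<in>{1..d}. quantile (abs_df (F i)) (U \<omega>)) (enn2ereal (quantile_product d F))"
proof -
  let ?g = "\<lambda>u. \<Prod>i\<in>{1..d}. quantile (abs_df (F i)) u"
  have gm: "?g \<in> borel_measurable borel"
    by (intro borel_measurable_prod measurable_quantile_abs_df)
  \<comment> \<open>The level \<open>(u + 1) / 2\<close> is the solution \<open>v\<close> of
    \<open>2 * v - 1 = u\<close> and lies above 1/2.\<close>
  have nonneg: "0 \<le> quantile (abs_df (F i)) u" if "0 < u" "u < 1" "i \<in> {1..d}" for i u
    using that quantile_abs_df[OF F sym, of i "(u + 1) / 2"] quantile_nonneg[OF F sym, of i "(u + 1) / 2"]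
    by (simp add: field_simps)
  have pos: "AE u in unif01. 0 < u \<and> u < 1"
    using AE_unif01_generic by eventually_elim blast
  have "AE \<omega> in P. 0 \<le> ?g (U \<omega>)"
    using AE_uniform01[OF U pos] by eventually_elim (intro prod_nonneg, simp add: nonneg)
  then have "has_expectation P (\<lambda>\<omega>. ?g (U \<omega>)) (enn2ereal (\<integral>\<^sup>+\<omega>. ennreal (?g (U \<omega>)) \<partial>P))"
    using U gm by (intro has_expectation_nonneg) (auto simp: uniform01_def intro: measurable_compose)
  also have "(\<integral>\<^sup>+\<omega>. ennreal (?g (U \<omega>)) \<partial>P) = (\<integral>\<^sup>+u. ennreal (?g u) \<partial>unif01)"
    using gm by (intro nn_integral_uniform01[OF U, of "\<lambda>u. ennreal (?g u)"]) simp
  also have "\<dots> = quantile_product d F"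
    unfolding quantile_product_def
  proof (rule nn_integral_cong_AE)
    show "AE u in unif01. ennreal (?g u) = (\<Prod>i\<in>{1..d}. ennreal (quantile (abs_df (F i)) u))"
      using pos by eventually_elim (intro prod_ennreal[symmetric] nonneg, auto)
  qed
  finally show ?thesis .
qed

text \<open>With every \<open>W i\<close> equal to \<open>U\<close>, the sign condition concerns an
  even power of \<open>U - 1/2\<close>.\<close>

lemma sign_aligned_vector_even:
  assumes "prob_space P" "uniform01 P U" "even d"
  shows "sign_aligned_vector P d F (\<lambda>i \<omega>. quantile (F i) (U \<omega>))"
  using assms by (intro sign_aligned_vector_quantiles) (auto simp: zero_le_even_power)

end

section \<open>The coupling for odd dimension\<close>

text \<open>The fair coin \<open>1/2 < V\<close> picks one of \<open>a U\<close> and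
  \<open>b U\<close>, which are \<open>U\<close> and \<open>1 - U\<close> in an order that may
  depend on \<open>U\<close>. Averaged over the coin, the law is the equal mixture of the laws of
  \<open>U\<close> and \<open>1 - U\<close>, both uniform.\<close>

lemma uniform01_indep_mixture:
  assumes P: "prob_space P" and U: "uniform01 P U" and V: "uniform01 P V"
    and ind: "prob_space.indep_var P borel U borel V"
    and [measurable]: "a \<in> borel_measurable borel" "b \<in> borel_measurable borel"
    and ab: "\<And>u. a u = u \<and> b u = 1 - u \<or> a u = 1 - u \<and> b u = u"
  shows "uniform01 P (\<lambda>\<omega>. if 1 / 2 < V \<omega> then a (U \<omega>) else b (U \<omega>))"
proof -
  interpret prob_space P by fact
  interpret U01: prob_space unif01 by (rule prob_space_unif01)
  have [measurable]: "U \<in> borel_measurable P" "V \<in> borel_measurable P"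
    and DU: "distr P borel U = unif01" and DV: "distr P borel V = unif01"
    using U V by (auto simp: uniform01_def)
  let ?Z = "\<lambda>\<omega>. if 1 / 2 < V \<omega> then a (U \<omega>) else b (U \<omega>)"
  have Vhalf: "prob (V -` {1/2<..} \<inter> space P) = 1 / 2" "prob (V -` {..1/2} \<inter> space P) = 1 / 2"
  proof -
    show le: "prob (V -` {..1/2} \<inter> space P) = 1 / 2"
      using measure_distr[of V P borel "{..1/2}"] measure_unif01_atMost[of "1/2"] by (simp add: DV)
    have "V -` {1/2<..} \<inter> space P = space P - (V -` {..1/2} \<inter> space P)" by auto
    then show "prob (V -` {1/2<..} \<inter> space P) = 1 / 2"
      using prob_compl[of "V -` {..1/2} \<inter> space P"] le by simp
  qed
  have measure_Z: "measure (distr P borel ?Z) A = measure unif01 A" if [measurable]: "A \<in> sets borel" for A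
  proof -
    have split: "prob ((\<lambda>\<omega>. (U \<omega>, V \<omega>)) -` (f -` A \<times> B) \<inter> space P) =
        measure unif01 (f -` A) * prob (V -` B \<inter> space P)"
      if [measurable]: "f \<in> borel_measurable borel" "B \<in> sets borel" for f B
    proof -
      have [measurable]: "f -` A \<in> sets borel" using measurable_sets[OF that(1), of A] by simp
      show ?thesis
        using indep_varD[OF ind, of "f -` A" B] measure_distr[of U P borel "f -` A"] by (simp add: DU)
    qed
    have ints: "integrable unif01 (\<lambda>u. indicator A (f u) :: real)" if "f \<in> borel_measurable borel" for f
      using that by (intro U01.integrable_const_bound[of _ 1]) auto
    have meas: "measure unif01 (f -` A) = (LINT u|unif01. indicator A (f u))"
      if "f \<in> borel_measurable borel" for f
    proof -
      have "f -` A \<in> sets borel" using measurable_sets[OF that, of A] by simp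
      then have "measure unif01 (f -` A) = (LINT u|unif01. indicator (f -` A) u)" by simp
      then show ?thesis by (simp add: indicator_def)
    qed
    have "measure unif01 ((\<lambda>u. 1 - u) -` A) = measure unif01 A"
      using measure_distr[of "\<lambda>u. 1 - u" unif01 borel A] by (simp add: distr_unif01_reflect)
    then have refl: "2 * measure unif01 A = measure unif01 ((\<lambda>u. u) -` A) + measure unif01 ((\<lambda>u. 1 - u) -` A)"
      by simp
    have "measure (distr P borel ?Z) A = prob (?Z -` A \<inter> space P)"
      by (rule measure_distr) auto
    also have "?Z -` A \<inter> space P = ((\<lambda>\<omega>. (U \<omega>, V \<omega>)) -` (a -` A \<times> {1/2<..}) \<inter> space P) \<union>
        ((\<lambda>\<omega>. (U \<omega>, V \<omega>)) -` (b -` A \<times> {..1/2}) \<inter> space P)" (is "_ = ?A1 \<union> ?A2")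
      by (auto split: if_splits)
    also have "prob (?A1 \<union> ?A2) = prob ?A1 + prob ?A2"
    proof (rule finite_measure_Union)
      have "?A1 = {\<omega> \<in> space P. a (U \<omega>) \<in> A \<and> 1/2 < V \<omega>}" "?A2 = {\<omega> \<in> space P. b (U \<omega>) \<in> A \<and> V \<omega> \<le> 1/2}"
        by auto
      then show "?A1 \<in> sets P" "?A2 \<in> sets P" by simp_all
    qed auto
    also have "\<dots> = (measure unif01 (a -` A) + measure unif01 (b -` A)) / 2"
      by (simp add: split Vhalf)
    \<comment> \<open>Under a common integral the two indicators can be exchanged pointwise, so the
      order in which \<open>a\<close> and \<open>b\<close> list \<open>u\<close> and
      \<open>1 - u\<close> disappears.\<close>
    also have "measure unif01 (a -` A) + measure unif01 (b -` A)
        = (LINT u|unif01. indicator A (a u) + indicator A (b u))"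
      by (simp add: meas ints)
    also have "\<dots> = (LINT u|unif01. indicator A u + indicator A (1 - u))"
    proof (rule Bochner_Integration.integral_cong)
      show "indicator A (a u) + indicator A (b u) = (indicator A u + indicator A (1 - u) :: real)" for u
        using ab[of u] by auto
    qed simp
    also have "\<dots> = 2 * measure unif01 A"
      unfolding refl by (simp add: meas ints)
    finally show ?thesis by simp
  qed
  have Zm: "?Z \<in> borel_measurable P" by simp
  interpret Z: prob_space "distr P borel ?Z" by (rule prob_space_distr[OF Zm])
  have "distr P borel ?Z = unif01"
  proof (rule measure_eqI)
    fix A assume "A \<in> sets (distr P borel ?Z)"
    then have "measure (distr P borel ?Z) A = measure unif01 A" by (intro measure_Z) simp
    then show "emeasure (distr P borel ?Z) A = emeasure unif01 A"
      unfolding Z.emeasure_eq_measure U01.emeasure_eq_measure by (rule arg_cong)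
  qed simp
  with Zm show ?thesis unfolding uniform01_def by blast
qed

lemma odd_coupling_penultimate: "odd_coupling d u v (d - 1) = (if 1 / 2 < v then u else 1 - u)"
  by (simp add: odd_coupling_def Let_def)

text \<open>This is the larger of \<open>u\<close> and \<open>1 - u\<close> if
  \<open>1/2 < v\<close> and the smaller otherwise, so its deviation from 1/2 is
  \<open>\<bar>u - 1/2\<bar>\<close> or the negative of that, as \<open>v\<close> decides.\<close>

lemma odd_coupling_last:
  assumes "2 \<le> d"
  shows "odd_coupling d u v d =
    (if 1 / 2 < v then (if 1 / 2 < u then u else 1 - u) else (if 1 / 2 < u then 1 - u else u))"
proof -
  have "d \<noteq> d - 1" using assms by simp
  then show ?thesis by (simp add: odd_coupling_def Let_def)
qed

lemma odd_coupling_other: "i \<noteq> d - 1 \<Longrightarrow> i \<noteq> d \<Longrightarrow> odd_coupling d u v i = u"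
  by (simp add: odd_coupling_def Let_def)

text \<open>With \<open>s = u - 1/2\<close> the last two deviations are \<open>s\<close> and
  \<open>\<bar>s\<bar>\<close>, or both negated, so their product is
  \<open>s * \<bar>s\<bar>\<close>. The other \<open>d - 2\<close> factors are \<open>s\<close>,
  which leaves \<open>\<bar>s\<bar>\<close> times the even power \<open>d - 1\<close> of
  \<open>s\<close>.\<close>

lemma prod_odd_coupling_nonneg:
  assumes "2 \<le> d" "odd d"
  shows "0 \<le> (\<Prod>i\<in>{1..d}. odd_coupling d u v i - 1 / 2)"
proof -
  define s where "s = u - 1 / 2"
  obtain n where d: "d = Suc (Suc n)" using assms by (metis add_2_eq_Suc le_Suc_ex)
  have "(\<Prod>i\<in>{1..d}. odd_coupling d u v i - 1 / 2) =
      (\<Prod>i\<in>{1..n}. odd_coupling d u v i - 1 / 2) *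
      (odd_coupling d u v (d - 1) - 1 / 2) * (odd_coupling d u v d - 1 / 2)"
    by (simp add: d)
  also have "(\<Prod>i\<in>{1..n}. odd_coupling d u v i - 1 / 2) = s ^ n"
    by (simp add: odd_coupling_other d s_def)
  also have "s ^ n * (odd_coupling d u v (d - 1) - 1 / 2) * (odd_coupling d u v d - 1 / 2)
      = s ^ n * (s * \<bar>s\<bar>)"
  proof -
    have "odd_coupling d u v (d - 1) - 1 / 2 = (if 1 / 2 < v then s else - s)"
      unfolding odd_coupling_penultimate by (simp add: s_def)
    moreover have "odd_coupling d u v d - 1 / 2 = (if 1 / 2 < v then \<bar>s\<bar> else - \<bar>s\<bar>)"
      unfolding odd_coupling_last[OF assms(1)] by (simp add: s_def)
    ultimately show ?thesis by simp
  qed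
  also have "\<dots> = s ^ Suc n * \<bar>s\<bar>" by simp
  also have "\<dots> \<ge> 0"
    using assms unfolding d by (intro mult_nonneg_nonneg zero_le_even_power) auto
  finally show ?thesis .
qed

lemma sign_aligned_vector_odd:
  assumes F: "\<And>i. i \<in> {1..d} \<Longrightarrow> distribution_function (F i)"
    and sym: "\<And>i. i \<in> {1..d} \<Longrightarrow> symmetric_df (F i)"
    and P: "prob_space P" and U: "uniform01 P U" and V: "uniform01 P V"
    and ind: "prob_space.indep_var P borel U borel V"
    and d: "2 \<le> d" "odd d"
  shows "sign_aligned_vector P d F (\<lambda>i \<omega>. quantile (F i) (odd_coupling d (U \<omega>) (V \<omega>) i))"
proof (rule sign_aligned_vector_quantiles[OF F sym P U])
  fix i
  consider "i = d - 1" | "i = d" | "i \<noteq> d - 1" "i \<noteq> d" by blast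
  then show "uniform01 P (\<lambda>\<omega>. odd_coupling d (U \<omega>) (V \<omega>) i)"
  proof cases
    case 1
    then show ?thesis
      unfolding 1 odd_coupling_penultimate
      by (intro uniform01_indep_mixture[OF P U V ind, of "\<lambda>u. u" "\<lambda>u. 1 - u"]) auto
  next
    case 2
    show ?thesis
      unfolding 2 odd_coupling_last[OF d(1)]
      \<comment> \<open>Neither branch is uniform by itself: almost surely the first stays in the
        upper half of the unit interval and the second in the lower half.\<close>
      by (intro uniform01_indep_mixture[OF P U V ind, of "\<lambda>u. if 1 / 2 < u then u else 1 - u"
            "\<lambda>u. if 1 / 2 < u then 1 - u else u"]) auto
  next
    case 3
    then show ?thesis using U by (simp add: odd_coupling_other)
  qed
  fix \<omega>
  show "odd_coupling d (U \<omega>) (V \<omega>) i \<in> {U \<omega>, 1 - U \<omega>}"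
    by (cases "i = d - 1"; cases "i = d")
       (use d in \<open>auto simp: odd_coupling_penultimate odd_coupling_last odd_coupling_other simp del: One_nat_def\<close>)
next
  fix \<omega>
  show "0 \<le> (\<Prod>i\<in>{1..d}. odd_coupling d (U \<omega>) (V \<omega>) i - 1 / 2)"
    by (rule prod_odd_coupling_nonneg[OF d])
qed auto

section \<open>Existence of the coupling and the value of the maximum\<close>

lemma independent_uniforms_exist:
  obtains Q :: "(nat \<Rightarrow> real) measure" and U V
  where "prob_space Q" "uniform01 Q U" "uniform01 Q V" "prob_space.indep_var Q borel U borel V"
proof -
  \<comment> \<open>An infinite product of uniform laws has sample points of the type used in
    \<open>max_product\<close>; coordinates 0 and 1 serve as \<open>U\<close> and
    \<open>V\<close>.\<close>
  define Q :: "(nat \<Rightarrow> real) measure" where "Q = PiM UNIV (\<lambda>_. unif01)"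
  interpret prob_space Q
    unfolding Q_def by (intro prob_space_PiM prob_space_unif01)
  have sets: "sets Q = sets (PiM UNIV (\<lambda>_. borel))"
    unfolding Q_def by (intro sets_PiM_cong) auto
  have comp: "(\<lambda>\<omega>. \<omega> i) \<in> borel_measurable Q" for i
    by (simp add: measurable_cong_sets[OF sets refl] measurable_component_singleton)
  have D: "distr Q borel (\<lambda>\<omega>. \<omega> i) = unif01" for i
  proof -
    have "distr Q borel (\<lambda>\<omega>. \<omega> i) = distr Q unif01 (\<lambda>\<omega>. \<omega> i)"
      by (rule distr_cong) auto
    also have "\<dots> = unif01"
      unfolding Q_def by (rule distr_PiM_component) (auto intro: prob_space_unif01)
    finally show ?thesis .
  qed
  \<comment> \<open>The joint law of all coordinates is \<open>Q\<close> itself, a product measure,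
    which is the criterion for independence.\<close>
  have "distr Q (PiM UNIV (\<lambda>_. borel)) (\<lambda>\<omega>. \<lambda>i\<in>UNIV. \<omega> i) = Q"
    using distr_id2[OF sets[symmetric]] by (simp add: restrict_UNIV)
  then have ind: "indep_vars (\<lambda>_. borel) (\<lambda>i \<omega>. \<omega> i) (UNIV :: nat set)"
    using indep_vars_iff_distr_eq_PiM'[where I = UNIV and M' = "\<lambda>_. borel" and X = "\<lambda>i \<omega>. \<omega> i"] comp
    by (simp add: D flip: Q_def)
  have "indep_var borel ((\<lambda>x. x 0) \<circ> (\<lambda>\<omega>. restrict (\<lambda>i. \<omega> i) {0}))
      borel ((\<lambda>x. x 1) \<circ> (\<lambda>\<omega>. restrict (\<lambda>i. \<omega> i) {1}))"
    by (rule indep_var_compose[OF indep_var_restrict[OF ind]])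
       (auto intro!: measurable_component_singleton)
  then have "indep_var borel (\<lambda>\<omega>. \<omega> 0) borel (\<lambda>\<omega>. \<omega> 1)" by (simp add: comp_def)
  then show ?thesis
    using that[of Q "\<lambda>\<omega>. \<omega> 0" "\<lambda>\<omega>. \<omega> 1"] comp D prob_space_axioms by (auto simp: uniform01_def)
qed

theorem theorem3p1:
  fixes d :: nat
    and F :: "nat \<Rightarrow> real \<Rightarrow> real"
    and P :: "'a measure"
    and U :: "'a \<Rightarrow> real"
  assumes "d \<ge> 2"
    and "\<And>i. i \<in> {1..d} \<Longrightarrow> distribution_function (F i)"
    and "\<And>i. i \<in> {1..d} \<Longrightarrow> square_integrable_df (F i)"
    and "\<And>i. i \<in> {1..d} \<Longrightarrow> mean_df (F i) = 0"
    and "\<And>i. i \<in> {1..d} \<Longrightarrow> symmetric_df (F i)"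
    and "prob_space P"
    and "uniform01 P U"
  shows "(\<exists>(Q :: (nat \<Rightarrow> real) measure) X.
            vector_with_dfs Q d F X \<and>
            comonotonic Q d (\<lambda>i \<omega>. \<bar>X i \<omega>\<bar>) \<and>
            (AE \<omega> in Q. 0 \<le> (\<Prod>i\<in>{1..d}. X i \<omega>)) \<and>
            attains_max_product Q d F X) \<and>
         has_expectation P (\<lambda>\<omega>. \<Prod>i\<in>{1..d}. quantile (abs_df (F i)) (U \<omega>)) (max_product d F) \<and>
         (odd d \<longrightarrow> (\<forall>V. uniform01 P V \<longrightarrow> prob_space.indep_var P borel U borel V \<longrightarrow>
            (let X = \<lambda>i \<omega>. quantile (F i) (odd_coupling d (U \<omega>) (V \<omega>) i) in
            vector_with_dfs P d F X \<and>
            comonotonic P d (\<lambda>i \<omega>. \<bar>X i \<omega>\<bar>) \<and>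
            (AE \<omega> in P. 0 \<le> (\<Prod>i\<in>{1..d}. X i \<omega>)) \<and>
            attains_max_product P d F X))) \<and>
         (even d \<longrightarrow> (let X = \<lambda>i \<omega>. quantile (F i) (U \<omega>) in
            vector_with_dfs P d F X \<and>
            comonotonic P d (\<lambda>i \<omega>. \<bar>X i \<omega>\<bar>) \<and>
            (AE \<omega> in P. 0 \<le> (\<Prod>i\<in>{1..d}. X i \<omega>)) \<and>
            attains_max_product P d F X))"
proof -
  note F = assms(2) and sym = assms(5)
  \<comment> \<open>The given space \<open>P\<close> need not carry a second uniform variable
    independent of \<open>U\<close>, so the existence claim is proved on a space built for
    it.\<close>
  obtain Q :: "(nat \<Rightarrow> real) measure" and U' V' where
    Q: "prob_space Q" "uniform01 Q U'" "uniform01 Q V'" "prob_space.indep_var Q borel U' borel V'"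
    by (rule independent_uniforms_exist)
  obtain X where X: "sign_aligned_vector Q d F X"
    using sign_aligned_vector_even[where d = d and F = F, OF F sym Q(1,2)]
      sign_aligned_vector_odd[where d = d and F = F, OF F sym Q assms(1)] by blast
  \<comment> \<open>Every competitor obeys the rearrangement bound, and \<open>X\<close> is a
    competitor that meets it.\<close>
  have max: "max_product d F = enn2ereal (quantile_product d F)"
  proof (rule antisym)
    show "max_product d F \<le> enn2ereal (quantile_product d F)"
      unfolding max_product_def using expectation_le_quantile_product[where d = d and F = F, OF F] by (intro Sup_least) blast
    show "enn2ereal (quantile_product d F) \<le> max_product d F"
      using X unfolding sign_aligned_vector_def by (blast intro: expectation_le_max_product)
  qed
  show ?thesis
    unfolding Let_def sign_aligned_vector_iff[OF max, symmetric]
    using X sign_aligned_vector_even[where d = d and F = F, OF F sym assms(6,7)]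
      sign_aligned_vector_odd[where d = d and F = F, OF F sym assms(6,7) _ _ assms(1)]
      has_expectation_quantile_abs_df[where d = d and F = F, OF F sym assms(7)]
    by (auto simp: max)
qed

end
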